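(* Let $d\ge 1$, let $A=M_d(\mathbb C)$, and let $\mathscr H$ be a Hilbert module over $A$. Suppose there exist vectors $g,h\in\mathscr H$ with $[g,h]=I$ (the identity matrix). Let $T:\mathscr H\to\mathscr H$ be a surjective map (linearity is not assumed) such that \[ |[Tf,Tf']|=|[f,f']|\qquad(f,f'\in\mathscr H). \] If $d>1$, then there exist an $A$-unitary operator $U:\mathscr H\to\mathscr H$ and a phase-function $\varphi:\mathscr H\to\mathbb C$ such that $Tf=\varphi(f)Uf$ for all $f\in\mathscr H$. If $d=1$, then there exist an operator $U$ on $\mathscr H$ which is either unitary or antiunitary and a phase-function $\varphi:\mathscr H\to\mathbb C$ such that $Tf=\varphi(f)Uf$ for all $f\in\mathscr H$.
   Context: For a $C^*$-algebra $A$, a (left) Hilbert $A$-module is a left $A$-module $\mathscr H$ with a map $[\cdot,\cdot]:\mathscr H\times\mathscr H\to A$ such that for all $f,g,h\in\mathscr H$, $a\in A$: $[f+g,h]=[f,h]+[g,h]$; $[af,g]=a[f,g]$; $[g,f]=[f,g]^*$; $[f,f]\ge 0$, and $[f,f]=0$ iff $f=0$; and $\mathscr H$ is complete in the norm $f\mapsto\|[f,f]\|^{1/2}$. For $A=M_d(\mathbb C)$, $\mathscr H$ is a complex vector space (scalar $\lambda$ acting as $\lambda I$) and a Hilbert space with inner product $\langle f,g\rangle=\operatorname{tr}[f,g]$. For $a\in A$, $|a|=(a^*a)^{1/2}$. A linear bijection $U:\mathscr H\to\mathscr H$ is $A$-unitary if $U(af)=aUf$ and $[Uf,Uf']=[f,f']$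 for all $f,f'\in\mathscr H$, $a\in A$. When $d=1$ (so $\mathscr H$ is a complex Hilbert space with $[\cdot,\cdot]$ its inner product), $U$ is unitary if it is an inner-product-preserving linear bijection, and antiunitary if it is a conjugate-linear bijection with $[Uf,Uf']=[f',f]$ for all $f,f'$. A phase-function is a function $\varphi:\mathscr H\to\mathbb C$ with $|\varphi(f)|=1$ for all $f$. *)

theory Defs
  imports "HOL-Analysis.Analysis"
begin

type_synonym 'n cmat = "complex^'n^'n"

definition madj :: "'n::finite cmat \<Rightarrow> 'n cmat" where
  "madj a = (\<chi> i j. cnj (a $ j $ i))"

definition mpos :: "'n::finite cmat \<Rightarrow> bool" where
  "mpos a \<longleftrightarrow> (\<forall>x::complex^'n. \<exists>r::real. r \<ge> 0 \<and>
      (\<Sum>i\<in>UNIV. cnj (x $ i) * (a *v x) $ i) = complex_of_real r)"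

definition mabs :: "'n::finite cmat \<Rightarrow> 'n cmat" where
  "mabs a = (THE b. mpos b \<and> b ** b = madj a ** a)"

definition mnorm :: "'n::finite cmat \<Rightarrow> real" where
  "mnorm a = onorm (\<lambda>x::complex^'n. a *v x)"

definition hnorm :: "('h \<Rightarrow> 'h \<Rightarrow> 'n::finite cmat) \<Rightarrow> 'h \<Rightarrow> real" where
  "hnorm ip f = sqrt (mnorm (ip f f))"

definition hilbert_module ::
  "('n::finite cmat \<Rightarrow> 'h::ab_group_add \<Rightarrow> 'h) \<Rightarrow> ('h \<Rightarrow> 'h \<Rightarrow> 'n cmat) \<Rightarrow> bool" where
  "hilbert_module act ip \<longleftrightarrow>
     (\<forall>a b f. act (a ** b) f = act a (act b f)) \<and>
     (\<forall>f. act (mat 1) f = f) \<and>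
     (\<forall>a f g. act a (f + g) = act a f + act a g) \<and>
     (\<forall>a b f. act (a + b) f = act a f + act b f) \<and>
     (\<forall>f g h. ip (f + g) h = ip f h + ip g h) \<and>
     (\<forall>a f g. ip (act a f) g = a ** ip f g) \<and>
     (\<forall>f g. ip g f = madj (ip f g)) \<and>
     (\<forall>f. mpos (ip f f)) \<and>
     (\<forall>f. ip f f = 0 \<longleftrightarrow> f = 0) \<and>
     (\<forall>X::nat \<Rightarrow> 'h. (\<forall>e>0. \<exists>N. \<forall>m\<ge>N. \<forall>n\<ge>N. hnorm ip (X m - X n) < e) \<longrightarrow>
        (\<exists>L. (\<lambda>n. hnorm ip (X n - L)) \<longlonglongrightarrow> 0))"

definition A_unitary ::
  "('n::finite cmat \<Rightarrow> 'h::ab_group_add \<Rightarrow> 'h) \<Rightarrow> ('h \<Rightarrow> 'h \<Rightarrow> 'n cmat) \<Rightarrow> ('h \<Rightarrow> 'h) \<Rightarrow> bool" where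
  "A_unitary act ip U \<longleftrightarrow> bij U \<and>
     (\<forall>f g. U (f + g) = U f + U g) \<and>
     (\<forall>a f. U (act a f) = act a (U f)) \<and>
     (\<forall>f g. ip (U f) (U g) = ip f g)"

text \<open>Unitary / antiunitary (used for d = 1); complex scalars act as \<lambda>I.\<close>
definition unitary_op ::
  "('n::finite cmat \<Rightarrow> 'h::ab_group_add \<Rightarrow> 'h) \<Rightarrow> ('h \<Rightarrow> 'h \<Rightarrow> 'n cmat) \<Rightarrow> ('h \<Rightarrow> 'h) \<Rightarrow> bool" where
  "unitary_op act ip U \<longleftrightarrow> bij U \<and>
     (\<forall>f g. U (f + g) = U f + U g) \<and>
     (\<forall>c f. U (act (mat c) f) = act (mat c) (U f)) \<and>
     (\<forall>f g. ip (U f) (U g) = ip f g)"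

definition antiunitary_op ::
  "('n::finite cmat \<Rightarrow> 'h::ab_group_add \<Rightarrow> 'h) \<Rightarrow> ('h \<Rightarrow> 'h \<Rightarrow> 'n cmat) \<Rightarrow> ('h \<Rightarrow> 'h) \<Rightarrow> bool" where
  "antiunitary_op act ip U \<longleftrightarrow> bij U \<and>
     (\<forall>f g. U (f + g) = U f + U g) \<and>
     (\<forall>c f. U (act (mat c) f) = act (mat (cnj c)) (U f)) \<and>
     (\<forall>f g. ip (U f) (U g) = ip g f)"

definition phase_function :: "('h \<Rightarrow> complex) \<Rightarrow> bool" where
  "phase_function \<phi> \<longleftrightarrow> (\<forall>f. cmod (\<phi> f) = 1)"

end

theory Submission
  imports Defs
begin

text \<open>
  Only the consequence \<open>[Tf',Tf] [Tf,Tf'] = [f',f] [f,f']\<close> of the hypothesis is used. Fix an index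
  \<open>k\<close>, let \<open>E\<^sub>i\<^sub>j\<close> be the matrix units and put \<open>K = E\<^sub>k\<^sub>k \<H>\<close>. With the coordinates
  \<open>f\<^sub>i = E\<^sub>k\<^sub>i f \<in> K\<close> the entries of \<open>[f,g]\<close> are \<open>\<langle>f\<^sub>i,g\<^sub>j\<rangle>\<close>, so \<open>\<H>\<close> is \<open>K\<^sup>d\<close>.
  The hypothesis forces \<open>T\<close> to map \<open>K\<close> onto \<open>K\<close> and to preserve \<open>|\<langle>x,y\<rangle>|\<close> there, so by Wigner's
  theorem \<open>T\<close> agrees on \<open>K\<close> up to phases with a unitary or antiunitary \<open>V\<close>. Testing a general \<open>f\<close>
  against all \<open>x \<in> K\<close> and writing \<open>(Tf)\<^sub>i = V p\<^sub>i\<close> gives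
  \<open>\<langle>f\<^sub>i,x\<rangle>\<langle>x,f\<^sub>j\<rangle> = \<langle>p\<^sub>i,x\<rangle>\<langle>x,p\<^sub>j\<rangle>\<close>, with the right-hand side conjugated if \<open>V\<close> is antiunitary. In
  the unitary case \<open>p\<^sub>i = c f\<^sub>i\<close> for one common phase \<open>c\<close>. The antiunitary case is impossible for
  \<open>d > 1\<close> because \<open>[g,h] = I\<close> makes two coordinates of \<open>g\<close> linearly independent.
\<close>

subsection \<open>The absolute value of a matrix\<close>

lemma madj_nth [simp]: "madj a $ i $ j = cnj (a $ j $ i)"
  by (simp add: madj_def)

lemma madj_madj [simp]: "madj (madj a) = a"
  by (simp add: vec_eq_iff)

lemma madj_mult: "madj (a ** b) = madj b ** madj a"
  by (simp add: vec_eq_iff matrix_matrix_mult_def mult.commute)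

lemma madj_diff: "madj (a - b) = madj a - madj b"
  by (simp add: vec_eq_iff)

lemma madj_mat_1 [simp]: "madj (mat 1) = mat 1"
  by (simp add: vec_eq_iff mat_def)

definition sesq :: "'n::finite cmat \<Rightarrow> complex^'n \<Rightarrow> complex^'n \<Rightarrow> complex" where
  "sesq a x y = (\<Sum>i\<in>UNIV. cnj (x $ i) * (a *v y) $ i)"

lemma mpos_alt: "mpos a \<longleftrightarrow> (\<forall>x. 0 \<le> Re (sesq a x x) \<and> Im (sesq a x x) = 0)"
proof -
  have "(\<exists>r\<ge>0. z = complex_of_real r) \<longleftrightarrow> 0 \<le> Re z \<and> Im z = 0" for z
    by (metis Im_complex_of_real Re_complex_of_real complex_is_Real_iff of_real_Re)
  then show ?thesis
    by (auto simp: mpos_def sesq_def)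
qed

lemma sesq_expand: "sesq a x y = (\<Sum>i\<in>UNIV. \<Sum>j\<in>UNIV. cnj (x $ i) * a $ i $ j * y $ j)"
  by (simp add: sesq_def matrix_vector_mult_def sum_distrib_left mult.assoc)

lemma sesq_add_left: "sesq a (x + y) z = sesq a x z + sesq a y z"
  by (simp add: sesq_def distrib_right sum.distrib)

lemma sesq_add_right: "sesq a x (y + z) = sesq a x y + sesq a x z"
  by (simp add: sesq_def matrix_vector_right_distrib distrib_left sum.distrib)

lemma sesq_axis: "sesq a (axis i c) (axis j d) = cnj c * a $ i $ j * d"
proof -
  have "(\<Sum>l\<in>UNIV. cnj (axis i c $ k) * a $ k $ l * axis j d $ l)
      = (if k = i then cnj c * a $ i $ j * d else 0)" for k
  proof -
    have "cnj (axis i c $ k) * a $ k $ l * axis j d $ l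
      = (if l = j then if k = i then cnj c * a $ i $ j * d else 0 else 0)" for l
      by (simp add: axis_def)
    then show ?thesis by simp
  qed
  then show ?thesis
    by (simp add: sesq_expand)
qed

lemma sesq_madj: "sesq a (m *v x) y = sesq (madj m ** a) x y"
proof -
  have "sesq a (m *v x) y = (\<Sum>i\<in>UNIV. \<Sum>k\<in>UNIV. cnj (m $ i $ k) * cnj (x $ k) * (a *v y) $ i)"
    by (simp add: sesq_def matrix_vector_mult_def sum_distrib_right)
  also have "\<dots> = (\<Sum>k\<in>UNIV. \<Sum>i\<in>UNIV. cnj (m $ i $ k) * cnj (x $ k) * (a *v y) $ i)"
    by (rule sum.swap)
  also have "\<dots> = sesq (madj m ** a) x y"
    by (simp add: sesq_def matrix_vector_mul_assoc[symmetric] matrix_vector_mult_def[of "madj m"]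
        sum_distrib_left mult_ac)
  finally show ?thesis .
qed

lemma mpos_congruence:
  assumes "mpos a"
  shows "mpos (madj m ** a ** m)"
proof -
  have "sesq (madj m ** a ** m) x x = sesq a (m *v x) (m *v x)" for x
    unfolding sesq_madj by (simp add: sesq_def matrix_vector_mul_assoc[symmetric])
  then show ?thesis
    using assms by (simp add: mpos_alt)
qed

text \<open>Positivity is tested on \<open>axis i 1 + axis j c\<close>. The values 0, 1, \<i> and
  minus the conjugate of \<open>a $ i $ j\<close> for \<open>c\<close> yield everything needed about
  the entries of a positive matrix.\<close>

lemma mpos_two:
  fixes i j :: "'n::finite" and c :: complex
  assumes "mpos a"
  defines "z \<equiv> a $ i $ i + a $ i $ j * c + cnj c * a $ j $ i + cnj c * a $ j $ j * c"
  shows "0 \<le> Re z" "Im z = 0"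
proof -
  have "sesq a (axis i 1 + axis j c) (axis i 1 + axis j c) = z"
    by (simp add: sesq_add_left sesq_add_right sesq_axis z_def)
  then show "0 \<le> Re z" "Im z = 0"
    using assms by (metis mpos_alt)+
qed

lemma mpos_diag:
  assumes "mpos a"
  shows "0 \<le> Re (a $ i $ i)" "Im (a $ i $ i) = 0"
  using mpos_two[OF assms, of i i 0] by simp_all

lemma mpos_hermitian:
  assumes "mpos a"
  shows "madj a = a"
proof -
  have "cnj (a $ j $ i) = a $ i $ j" for i j
  proof (rule complex_eqI)
    \<comment> \<open>Polarization: \<open>c = 1\<close> makes a_ij + a_ji real, and
      \<open>c = \<i>\<close> makes \<i> (a_ij - a_ji) real.\<close>
    show "Im (cnj (a $ j $ i)) = Im (a $ i $ j)"
      using mpos_two(2)[OF assms, of i j 1] mpos_diag(2)[OF assms] by simp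
    show "Re (cnj (a $ j $ i)) = Re (a $ i $ j)"
      using mpos_two(2)[OF assms, of i j \<i>] mpos_diag(2)[OF assms] by simp
  qed
  then show ?thesis
    by (simp add: vec_eq_iff)
qed

lemma mpos_trace:
  assumes "mpos a"
  shows "0 \<le> Re (trace a)"
  using mpos_diag[OF assms] by (simp add: trace_def sum_nonneg)

lemma mpos_trace_zero:
  assumes a: "mpos a" and "Re (trace a) = 0"
  shows "a = 0"
proof -
  have d: "a $ i $ i = 0" for i
  proof -
    have "(\<Sum>i\<in>UNIV. Re (a $ i $ i)) = 0"
      using assms(2) by (simp add: trace_def)
    then have "Re (a $ i $ i) = 0"
      using mpos_diag[OF a] by (subst (asm) sum_nonneg_eq_0_iff) auto
    then show ?thesis
      using mpos_diag[OF a] by (simp add: complex_eq_iff)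
  qed
  have "a $ i $ j = 0" for i j
  proof -
    have h: "a $ j $ i = cnj (a $ i $ j)"
      using mpos_hermitian[OF a] by (metis madj_nth)
    \<comment> \<open>As the diagonal vanishes, this choice of \<open>c\<close> reduces the
      quadratic form to -2 |a_ij|^2.\<close>
    have "0 \<le> - (2 * ((Re (a $ i $ j))\<^sup>2 + (Im (a $ i $ j))\<^sup>2))"
      using mpos_two(1)[OF a, of i j "- cnj (a $ i $ j)"] d h by (simp add: power2_eq_square)
    then show ?thesis
      by (simp add: complex_eq_iff flip: sum_power2_eq_zero_iff) (smt (verit) zero_le_power2)
  qed
  then show ?thesis
    by (simp add: vec_eq_iff)
qed

text \<open>The (i,i) entry of m* m is the squared norm of column i of m.\<close>

lemma madj_mult_self_eq_0:
  assumes "madj m ** m = 0"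
  shows "m = 0"
proof -
  have "m $ k $ i = 0" for k i
  proof -
    have "(\<Sum>k\<in>UNIV. cnj (m $ k $ i) * m $ k $ i) = (madj m ** m) $ i $ i"
      by (simp add: matrix_matrix_mult_def)
    also have "\<dots> = 0"
      by (simp add: assms)
    finally have "(\<Sum>k\<in>UNIV. (cmod (m $ k $ i))\<^sup>2) = 0"
      by (metis (no_types, lifting) complex_norm_square mult.commute of_real_eq_0_iff of_real_sum sum.cong)
    then show ?thesis
      by (subst (asm) sum_nonneg_eq_0_iff) auto
  qed
  then show ?thesis
    by (simp add: vec_eq_iff)
qed

lemma matrix_mul_0 [simp]: "(0::complex^'n^'m) ** (a::complex^'k^'n) = 0" "(b::complex^'m^'k) ** (0::complex^'n^'m) = 0"
  by (simp_all add: matrix_matrix_mult_def vec_eq_iff)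

lemma matrix_diff_ldistrib: "(a::complex^'n^'m) ** (b - c) = a ** b - a ** (c::complex^'k^'n)"
  by (simp add: matrix_matrix_mult_def vec_eq_iff sum_subtractf right_diff_distrib)

lemma matrix_diff_rdistrib: "(b - c) ** (a::complex^'k^'n) = b ** a - c ** (a::complex^'k^'n)"
  by (simp add: matrix_matrix_mult_def vec_eq_iff sum_subtractf left_diff_distrib)

text \<open>With \<open>D = b - c\<close> one has \<open>b D + D c = 0\<close>; multiplying by \<open>D\<close> and taking traces kills both
  positive matrices \<open>D b D\<close> and \<open>D c D\<close>, whose difference is \<open>D\<^sup>3\<close>.\<close>

lemma mpos_sqrt_unique:
  assumes b: "mpos b" and c: "mpos c" and eq: "b ** b = c ** c"
  shows "b = (c::'n::finite cmat)"
proof -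
  define D where "D = b - c"
  have D: "madj D = D"
    using assms by (simp add: D_def madj_diff mpos_hermitian)
  have pb: "mpos (D ** b ** D)" and pc: "mpos (D ** c ** D)"
    using mpos_congruence[of _ D] b c D by auto
  have "trace (D ** c ** D) = trace (D ** (D ** c))"
    using trace_mul_sym by blast
  moreover have "b ** D + D ** c = 0"
    by (simp add: D_def eq matrix_diff_ldistrib matrix_diff_rdistrib)
  then have "D ** (b ** D) + D ** (D ** c) = 0"
    by (metis matrix_add_ldistrib matrix_mul_0(2))
  then have "trace (D ** b ** D) + trace (D ** (D ** c)) = 0"
    by (metis matrix_mul_assoc trace_0 trace_add mat_0)
  ultimately have "Re (trace (D ** b ** D)) + Re (trace (D ** c ** D)) = 0"
    by (metis plus_complex.simps(1) zero_complex.simps(1))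
  then have "Re (trace (D ** b ** D)) = 0" "Re (trace (D ** c ** D)) = 0"
    using mpos_trace[OF pb] mpos_trace[OF pc] by linarith+
  then have "D ** b ** D = 0" "D ** c ** D = 0"
    using mpos_trace_zero pb pc by blast+
  then have "D ** D ** D = 0"
    by (simp add: D_def matrix_diff_ldistrib matrix_diff_rdistrib)
  \<comment> \<open>D^3 = 0 gives (D^2)* D^2 = D^4 = 0, which kills D^2 and then D.\<close>
  then have "madj (D ** D) ** (D ** D) = 0"
    by (simp add: D madj_mult matrix_mul_assoc)
  then have "D ** D = 0"
    by (rule madj_mult_self_eq_0)
  then have "D = 0"
    using madj_mult_self_eq_0[of D] D by simp
  then show ?thesis
    by (simp add: D_def)
qed

section \<open>Existence of the positive square root by maximizing over unitaries\<close>

definition unitaries :: "'n::finite cmat set" where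
  "unitaries = {u. madj u ** u = mat 1}"

text \<open>The set is closed, being cut out by continuous equations in the entries, and bounded,
  because columns are unit vectors. Compactness supplies the maximizer in
  \<open>mpos_polar\<close>.\<close>

lemma compact_unitaries: "compact (unitaries :: 'n::finite cmat set)"
proof -
  have "closed {u::'n cmat. \<forall>i j. (\<Sum>k\<in>UNIV. cnj (u $ k $ i) * u $ k $ j) = mat 1 $ i $ j}"
    by (intro closed_Collect_all closed_Collect_eq continuous_intros)
  moreover have "unitaries = {u::'n cmat. \<forall>i j. (\<Sum>k\<in>UNIV. cnj (u $ k $ i) * u $ k $ j) = mat 1 $ i $ j}"
    by (auto simp: unitaries_def vec_eq_iff matrix_matrix_mult_def)
  ultimately have cl: "closed (unitaries :: 'n cmat set)"
    by simp
  have "norm u \<le> real CARD('n) * real CARD('n)" if "u \<in> unitaries" for u :: "'n cmat"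
  proof -
    have "norm (u $ k $ i) \<le> 1" for k i
    proof -
      have "(\<Sum>k\<in>UNIV. cnj (u $ k $ i) * u $ k $ i) = (madj u ** u) $ i $ i"
        by (simp add: matrix_matrix_mult_def)
      also have "\<dots> = 1"
        using that by (simp add: unitaries_def mat_def)
      finally have "(\<Sum>k\<in>UNIV. (cmod (u $ k $ i))\<^sup>2) = 1"
        by (metis (no_types, lifting) complex_norm_square mult.commute of_real_eq_1_iff of_real_sum sum.cong)
      then have "(cmod (u $ k $ i))\<^sup>2 \<le> 1"
        using member_le_sum[of k UNIV "\<lambda>k. (cmod (u $ k $ i))\<^sup>2"] by simp
      then show ?thesis
        by (simp add: power_le_one_iff)
    qed
    then have "norm (u $ k) \<le> (\<Sum>i\<in>(UNIV::'n set). 1)" for k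
      unfolding norm_vec_def by (intro order_trans[OF L2_set_le_sum] sum_mono) auto
    then have "norm u \<le> (\<Sum>k\<in>(UNIV::'n set). \<Sum>i\<in>(UNIV::'n set). 1)"
      unfolding norm_vec_def[of u] by (intro order_trans[OF L2_set_le_sum] sum_mono) auto
    then show ?thesis
      by simp
  qed
  then have "bounded (unitaries :: 'n cmat set)"
    by (meson boundedI)
  with cl show ?thesis
    by (simp add: compact_eq_bounded_closed)
qed

lemma sum_mat_1:
  fixes f :: "'n::finite \<Rightarrow> complex"
  shows "(\<Sum>k\<in>UNIV. mat 1 $ k $ i * f k) = f i" "(\<Sum>k\<in>UNIV. mat 1 $ i $ k * f k) = f i"
proof -
  have "mat 1 $ k $ i * f k = (if k = i then f k else 0)" "mat 1 $ i $ k * f k = (if i = k then f k else 0)" for k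
    by (simp_all add: mat_def)
  then show "(\<Sum>k\<in>UNIV. mat 1 $ k $ i * f k) = f i" "(\<Sum>k\<in>UNIV. mat 1 $ i $ k * f k) = f i"
    by simp_all
qed

text \<open>The reflection-like unitary \<open>1 + (w - 1) x x\<^sup>* / |x|\<^sup>2\<close> rotates \<open>x\<close> by the phase \<open>w\<close>.\<close>

lemma unitary_rotation:
  fixes x :: "complex^'n::finite"
  assumes n: "(\<Sum>i\<in>UNIV. (cmod (x $ i))\<^sup>2) = n" "n \<noteq> 0" and w: "cmod w = 1"
  defines "v \<equiv> (\<chi> i j. mat 1 $ i $ j + (w - 1) / of_real n * (x $ i * cnj (x $ j)))"
  shows "v \<in> unitaries" and "trace (v ** p) = trace p + (w - 1) / of_real n * sesq p x x"
proof -
  define t where "t = (w - 1) / of_real n"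
  have xx: "(\<Sum>k\<in>UNIV. x $ k * cnj (x $ k)) = of_real n"
    by (simp only: complex_norm_square[symmetric] of_real_sum[symmetric] n(1))
  have ww: "w * cnj w = 1"
    by (simp add: complex_norm_square[symmetric] w)
  \<comment> \<open>Since 1 + t n = w, this is |w|^2 = 1 in terms of t; unitarity of 1 + t x x*
    reduces to it.\<close>
  have t: "t + cnj t + cnj t * t * of_real n = 0"
    using n(2) ww by (simp add: t_def field_simps)
  have "(madj v ** v) $ i $ j = mat 1 $ i $ j" for i j
  proof -
    have "(madj v ** v) $ i $ j = (\<Sum>k\<in>UNIV. (mat 1 $ k $ i + cnj t * (cnj (x $ k) * x $ i))
        * (mat 1 $ k $ j + t * (x $ k * cnj (x $ j))))"
      by (auto simp: matrix_matrix_mult_def v_def t_def mat_def intro!: sum.cong)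
    also have "\<dots> = (\<Sum>k\<in>UNIV. mat 1 $ k $ i * mat 1 $ k $ j)
       + (\<Sum>k\<in>UNIV. mat 1 $ k $ i * (t * (x $ k * cnj (x $ j))))
       + (\<Sum>k\<in>UNIV. mat 1 $ k $ j * (cnj t * (cnj (x $ k) * x $ i)))
       + (\<Sum>k\<in>UNIV. cnj t * t * x $ i * cnj (x $ j) * (x $ k * cnj (x $ k)))"
      by (simp add: sum.distrib[symmetric] algebra_simps)
    also have "\<dots> = mat 1 $ i $ j + t * (x $ i * cnj (x $ j)) + cnj t * (cnj (x $ j) * x $ i)
       + cnj t * t * x $ i * cnj (x $ j) * of_real n"
      unfolding sum_mat_1 by (simp only: sum_distrib_left[symmetric] xx)
    also have "\<dots> = mat 1 $ i $ j + (t + cnj t + cnj t * t * of_real n) * (x $ i * cnj (x $ j))"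
      by (simp add: algebra_simps)
    finally show ?thesis
      by (simp add: t)
  qed
  then show "v \<in> unitaries"
    by (simp add: unitaries_def vec_eq_iff)
  have "trace (v ** p) = (\<Sum>i\<in>UNIV. \<Sum>k\<in>UNIV. mat 1 $ i $ k * p $ k $ i)
      + (\<Sum>i\<in>UNIV. \<Sum>k\<in>UNIV. t * (cnj (x $ k) * p $ k $ i * x $ i))"
    by (simp add: trace_def matrix_matrix_mult_def v_def t_def sum.distrib[symmetric] algebra_simps)
  also have "(\<Sum>i\<in>UNIV. \<Sum>k\<in>UNIV. t * (cnj (x $ k) * p $ k $ i * x $ i)) = t * sesq p x x"
    by (subst sum.swap) (simp only: sesq_expand sum_distrib_left)
  also have "(\<Sum>i\<in>UNIV. \<Sum>k\<in>UNIV. mat 1 $ i $ k * p $ k $ i) = trace p"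
    by (simp only: sum_mat_1 trace_def)
  finally show "trace (v ** p) = trace p + (w - 1) / of_real n * sesq p x x"
    by (simp add: t_def)
qed

text \<open>If the unitary \<open>u\<close> maximizes \<open>Re tr (u a)\<close>, then \<open>u a\<close> is positive, hence equal to \<open>|a|\<close>.\<close>

lemma mpos_polar:
  fixes a :: "'n::finite cmat"
  obtains b where "mpos b" "b ** b = madj a ** a"
proof -
  have ne: "(unitaries :: 'n cmat set) \<noteq> {}"
    by (auto simp: unitaries_def intro!: exI[of _ "mat 1"])
  have "continuous_on unitaries (\<lambda>u::'n cmat. Re (trace (u ** a)))"
    unfolding trace_def matrix_matrix_mult_def by (simp, intro continuous_intros)
  then obtain u where u: "u \<in> unitaries"
    and max: "\<And>v. v \<in> unitaries \<Longrightarrow> Re (trace (v ** a)) \<le> Re (trace (u ** a))"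
    using continuous_attains_sup[OF compact_unitaries ne] by blast
  have pos: "0 \<le> Re (sesq (u ** a) x x) \<and> Im (sesq (u ** a) x x) = 0" for x
  proof (cases "x = 0")
    case False
    define n where "n = (\<Sum>i\<in>UNIV. (cmod (x $ i))\<^sup>2)"
    obtain i where "x $ i \<noteq> 0"
      using False by (auto simp: vec_eq_iff)
    then have n: "n > 0"
      unfolding n_def by (intro sum_pos2[of _ i]) auto
    define z where "z = sesq (u ** a) x x"
    \<comment> \<open>Rotating x by w replaces the maximizer u by \<open>v ** u\<close> and adds (w
      - 1) z / n to the trace, whose real part cannot grow.\<close>
    have *: "Re ((w - 1) * z) \<le> 0" if w: "cmod w = 1" for w
    proof -
      obtain v :: "'n cmat" where v: "v \<in> unitaries"
        "trace (v ** (u ** a)) = trace (u ** a) + (w - 1) / of_real n * z"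
        using unitary_rotation[OF n_def[symmetric] _ w] n unfolding z_def by blast
      have "v ** u \<in> unitaries"
        using u v(1) unfolding unitaries_def
        by simp (metis madj_mult matrix_mul_assoc matrix_mul_lid)
      from max[OF this] have "Re ((w - 1) / of_real n * z) \<le> 0"
        using v(2) by (simp add: matrix_mul_assoc)
      also have "(w - 1) / of_real n * z = (w - 1) * z / of_real n"
        by simp
      finally show ?thesis
        using n by (simp add: divide_le_0_iff)
    qed
    \<comment> \<open>The choice w = conj(z) / |z| gives |z| \<le> Re z, which forces z to be real
      and nonnegative.\<close>
    have "cmod z \<le> Re z"
    proof (cases "z = 0")
      case False
      then have "Re ((cnj z / of_real (cmod z) - 1) * z) \<le> 0"
        by (intro *) (simp add: norm_divide)
      moreover have "(cnj z / of_real (cmod z) - 1) * z = of_real (cmod z) - z"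
        using False by (simp add: left_diff_distrib mult.commute[of "cnj z"] power2_eq_square
            flip: complex_norm_square)
      ultimately show ?thesis
        by simp
    qed simp
    then show ?thesis
      unfolding z_def[symmetric] by (smt (verit) cmod_power2 norm_ge_zero power_mono zero_le_power2 power_eq_0_iff)
  qed (simp add: sesq_def)
  then have p: "mpos (u ** a)"
    by (simp add: mpos_alt)
  have "(u ** a) ** (u ** a) = madj (u ** a) ** (u ** a)"
    using mpos_hermitian[OF p] by simp
  also have "\<dots> = madj a ** (madj u ** u) ** a"
    by (simp add: madj_mult matrix_mul_assoc)
  also have "\<dots> = madj a ** a"
    using u by (simp add: unitaries_def)
  finally show ?thesis
    using p that by blast
qed

text \<open>The definite description in \<open>mabs\<close> denotes because of
  \<open>mpos_polar\<close> (existence) and \<open>mpos_sqrt_unique\<close> (uniqueness).\<close>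

lemma mabs_square: "mabs a ** mabs a = madj a ** a"
proof -
  have "\<exists>!b. mpos b \<and> b ** b = madj a ** a"
    by (metis mpos_polar mpos_sqrt_unique)
  from theI'[OF this] show ?thesis
    unfolding mabs_def by blast
qed

subsection \<open>Wigner's theorem\<close>

text \<open>The space is a carrier set inside the group because it will be a corner of the module.
  Definiteness is asked on \<open>K\<close> alone: the form used later, a single diagonal entry of
  \<open>ip\<close>, may vanish on nonzero vectors outside.\<close>

locale complex_inner_subspace =
  fixes K :: "'h::ab_group_add set"
    and scl :: "complex \<Rightarrow> 'h \<Rightarrow> 'h" (infixr "\<cdot>" 75)
    and inn :: "'h \<Rightarrow> 'h \<Rightarrow> complex"
  assumes add_in: "x \<in> K \<Longrightarrow> y \<in> K \<Longrightarrow> x + y \<in> K"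
    and scl_in: "x \<in> K \<Longrightarrow> c \<cdot> x \<in> K"
    and scl_add: "c \<cdot> (x + y) = c \<cdot> x + c \<cdot> y"
    and add_scl: "(c + d) \<cdot> x = c \<cdot> x + d \<cdot> x"
    and scl_scl: "c \<cdot> d \<cdot> x = (c * d) \<cdot> x"
    and scl_one: "1 \<cdot> x = x"
    and inn_add_left: "inn (x + y) z = inn x z + inn y z"
    and inn_scl_left: "inn (c \<cdot> x) y = c * inn x y"
    and inn_cnj: "inn y x = cnj (inn x y)"
    and inn_ge: "0 \<le> Re (inn x x)"
    and inn_eq_0: "x \<in> K \<Longrightarrow> inn x x = 0 \<Longrightarrow> x = 0"
begin

lemma zero_scl [simp]: "0 \<cdot> x = 0"
  using add_scl[of 0 0 x] by simp

lemma minus_scl: "(- c) \<cdot> x = - (c \<cdot> x)"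
  using add_scl[of c "- c" x] by (simp add: eq_neg_iff_add_eq_0 add.commute)

lemma scl_zero [simp]: "c \<cdot> 0 = 0"
  using scl_add[of c 0 0] by simp

lemma minus_eq_scl: "- x = (- 1) \<cdot> x"
  by (simp add: minus_scl scl_one)

lemma diff_eq_scl: "x - y = x + (- 1) \<cdot> y"
  by (simp add: minus_eq_scl[symmetric])

lemma scl_diff: "c \<cdot> (x - y) = c \<cdot> x - c \<cdot> y"
  by (simp add: diff_eq_scl scl_scl scl_add)

lemma diff_in: "x \<in> K \<Longrightarrow> y \<in> K \<Longrightarrow> x - y \<in> K"
  by (simp add: diff_eq_scl add_in scl_in)

lemma inn_add_right: "inn x (y + z) = inn x y + inn x z"
  by (metis complex_cnj_add inn_add_left inn_cnj)

lemma inn_scl_right: "inn x (c \<cdot> y) = cnj c * inn x y"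
  by (metis complex_cnj_mult inn_cnj inn_scl_left)

lemma inn_diff_left: "inn (x - y) z = inn x z - inn y z"
  by (simp add: diff_eq_scl inn_add_left inn_scl_left)

lemma inn_diff_right: "inn x (y - z) = inn x y - inn x z"
  by (simp add: diff_eq_scl inn_add_right inn_scl_right)

lemma inn_zero [simp]: "inn 0 x = 0" "inn x 0 = 0"
  using inn_scl_left[of 0 x x] inn_scl_right[of x 0 x] by simp_all

lemmas inn_simps = inn_add_left inn_add_right inn_scl_left inn_scl_right inn_diff_left inn_diff_right

lemma Im_inn_self: "Im (inn x x) = 0"
  using inn_cnj[of x x] by (simp add: complex_eq_iff)

lemma inn_self: "inn x x = of_real (cmod (inn x x))"
  using Im_inn_self[of x] inn_ge[of x] by (simp add: complex_eq_iff cmod_eq_Re)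

lemma inn_self_eqI:
  assumes "cmod (inn x x) = cmod (inn y y)"
  shows "inn x x = inn y y"
  by (metis assms inn_self)

lemma Re_inn_eq_0:
  assumes "x \<in> K" "Re (inn x x) = 0"
  shows "x = 0"
  using assms by (intro inn_eq_0) (auto simp: complex_eq_iff Im_inn_self)

text \<open>Equality case of Cauchy-Schwarz: for c = <y,x> / <x,x> the residual y - c x has squared
  norm (1 - |c|^2) <x,x> = 0.\<close>

lemma Cauchy_Schwarz_eq_phase:
  assumes "x \<in> K" "y \<in> K" "inn x x = inn y y" "cmod (inn x y) = cmod (inn x x)"
  shows "\<exists>c. cmod c = 1 \<and> y = c \<cdot> x"
proof (cases "x = 0")
  case True
  then have "y = 0"
    using assms by (simp add: inn_eq_0)
  then show ?thesis
    using True by (intro exI[of _ 1]) simp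
next
  case False
  define r where "r = cmod (inn x x)"
  have r: "inn x x = of_real r" "inn y y = of_real r"
    using inn_self[of x] assms(3) by (simp_all add: r_def)
  have "r > 0"
    using False inn_eq_0[OF assms(1)] by (auto simp: r_def)
  define c where "c = inn y x / of_real r"
  have yx: "inn y x = c * of_real r"
    using \<open>r > 0\<close> by (simp add: c_def)
  have xy: "inn x y = cnj c * of_real r"
    by (metis complex_cnj_complex_of_real complex_cnj_mult inn_cnj yx)
  have c: "cmod c = 1"
    using assms(4) \<open>r > 0\<close> unfolding xy r by (simp add: norm_mult)
  then have cc: "c * cnj c = 1"
    by (simp flip: complex_norm_square)
  have "inn (y - c \<cdot> x) (y - c \<cdot> x) = of_real r - (c * cnj c) * of_real r"
    by (simp add: inn_simps xy yx r algebra_simps)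
  then have "y - c \<cdot> x = 0"
    using cc assms by (intro inn_eq_0) (auto intro: diff_in scl_in)
  then show ?thesis
    using c by auto
qed

text \<open>Testing at x = a and at x = b gives equal norms and equality in Cauchy-Schwarz.\<close>

lemma phase_of_mod_eq:
  assumes "a \<in> K" "b \<in> K" and "\<And>x. x \<in> K \<Longrightarrow> cmod (inn a x) = cmod (inn b x)"
  shows "\<exists>c. cmod c = 1 \<and> b = c \<cdot> a"
proof (rule Cauchy_Schwarz_eq_phase)
  have "cmod (inn b a) = cmod (inn a b)"
    by (metis complex_mod_cnj inn_cnj)
  then show "inn a a = inn b b" "cmod (inn a b) = cmod (inn a a)"
    using assms by (auto intro!: inn_self_eqI)
qed (use assms in auto)

text \<open>The rank-one operators \<open>a\<^sub>i a\<^sub>j\<^sup>*\<close> determine the family \<open>a\<close> up to one common phase.\<close>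

lemma common_phase:
  assumes in_K: "\<And>i. a i \<in> K" "\<And>i. p i \<in> K"
    and eq: "\<And>i j x. x \<in> K \<Longrightarrow> inn (a i) x * inn x (a j) = inn (p i) x * inn x (p j)"
  shows "\<exists>c. cmod c = 1 \<and> (\<forall>i. p i = c \<cdot> a i)"
proof -
  have "cmod (inn (a i) x) = cmod (inn (p i) x)" if "x \<in> K" for i x
  proof -
    have "inn y x * inn x y = of_real ((cmod (inn y x))\<^sup>2)" for y
      by (subst inn_cnj[of x y]) (simp only: complex_norm_square)
    then have "(cmod (inn (a i) x))\<^sup>2 = (cmod (inn (p i) x))\<^sup>2"
      using eq[OF that, of i i] by (metis of_real_eq_iff)
    then show ?thesis
      by simp
  qed
  then have "\<exists>c. cmod c = 1 \<and> p i = c \<cdot> a i" for i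
    using in_K by (intro phase_of_mod_eq)
  then obtain c where c: "\<And>i. cmod (c i) = 1" "\<And>i. p i = c i \<cdot> a i"
    by metis
  show ?thesis
  proof (cases "\<forall>i. a i = 0")
    case True
    then show ?thesis
      using c(2) by (intro exI[of _ 1]) simp
  next
    case False
    then obtain m where m: "a m \<noteq> 0" by blast
    have "p i = c m \<cdot> a i" for i
    proof (cases "a i = 0")
      case True
      then show ?thesis
        using c(2)[of i] by simp
    next
      case False
      have nz: "inn (a i) (a i) \<noteq> 0" "inn (a m) (a m) \<noteq> 0"
        using m False inn_eq_0 in_K by blast+
      \<comment> \<open>The test vector must overlap both a_i and a_m: a_m itself does, unless the
        two are orthogonal, and then their sum does.\<close>
      obtain x where x: "x \<in> K" "inn (a i) x \<noteq> 0" "inn x (a m) \<noteq> 0"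
      proof (cases "inn (a i) (a m) = 0")
        case True
        then have "inn (a m) (a i) = 0"
          using inn_cnj[of "a m" "a i"] by simp
        then show ?thesis
          using that[of "a i + a m"] True nz in_K by (simp add: add_in inn_simps)
      next
        case False
        then show ?thesis
          using that[of "a m"] nz in_K by simp
      qed
      have "inn (a i) x * inn x (a m) = (c i * cnj (c m)) * (inn (a i) x * inn x (a m))"
        using eq[OF x(1), of i m] by (simp add: c(2) inn_simps mult_ac)
      then have "c i * cnj (c m) = 1"
        using x by simp
      moreover have "c m * cnj (c m) = 1"
        using c(1)[of m] by (simp flip: complex_norm_square)
      ultimately have "c i = c m"
        by (metis mult_cancel_right mult_zero_right zero_neq_one)
      then show ?thesis
        by (simp add: c(2))
    qed
    then show ?thesis
      using c(1) by blast
  qed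
qed

text \<open>Fix a unit vector \<open>e\<close> and put \<open>e' = \<tau> e\<close>. On the hyperplane \<open>e + e\<^sup>\<bottom>\<close> the phases can be
  normalized by \<open>\<tau> (e + u) \<sim> e' + \<sigma> u\<close> with \<open>\<sigma> u \<bottom> e'\<close>. Then \<open>\<sigma>\<close> preserves both
  \<open>|1 + \<langle>u,v\<rangle>|\<close> and \<open>|\<langle>u,v\<rangle>|\<close>, hence the real inner product, and is therefore additive;
  moreover \<open>\<sigma> (i u) = \<plusminus> i \<sigma> u\<close> with a sign independent of \<open>u\<close>.\<close>

theorem wigner:
  assumes \<tau>_in: "\<And>x. x \<in> K \<Longrightarrow> \<tau> x \<in> K"
    and \<tau>: "\<And>x y. x \<in> K \<Longrightarrow> y \<in> K \<Longrightarrow> cmod (inn (\<tau> x) (\<tau> y)) = cmod (inn x y)"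
    and ex: "x\<^sub>0 \<in> K" "x\<^sub>0 \<noteq> 0"
  obtains \<kappa> V where "\<kappa> = id \<or> \<kappa> = cnj" "\<And>x. x \<in> K \<Longrightarrow> V x \<in> K"
    "\<And>x y. x \<in> K \<Longrightarrow> y \<in> K \<Longrightarrow> V (x + y) = V x + V y"
    "\<And>c x. x \<in> K \<Longrightarrow> V (c \<cdot> x) = \<kappa> c \<cdot> V x"
    "\<And>x y. x \<in> K \<Longrightarrow> y \<in> K \<Longrightarrow> inn (V x) (V y) = \<kappa> (inn x y)"
    "\<And>x. x \<in> K \<Longrightarrow> \<exists>c. cmod c = 1 \<and> \<tau> x = c \<cdot> V x"
proof -
  have \<tau>_self: "inn (\<tau> x) (\<tau> x) = inn x x" if "x \<in> K" for x
    using that by (intro inn_self_eqI \<tau>)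
  obtain e where e: "e \<in> K" "inn e e = 1"
  proof -
    define r where "r = cmod (inn x\<^sub>0 x\<^sub>0)"
    have r: "inn x\<^sub>0 x\<^sub>0 = of_real r" "r > 0"
      using inn_self ex inn_eq_0 by (auto simp: r_def)
    have "inn (of_real (1 / sqrt r) \<cdot> x\<^sub>0) (of_real (1 / sqrt r) \<cdot> x\<^sub>0)
        = of_real (1 / sqrt r * (1 / sqrt r) * r)"
      by (simp only: inn_scl_left inn_scl_right r complex_cnj_complex_of_real of_real_mult mult.assoc)
    also have "\<dots> = 1"
      using r(2) by simp
    finally show ?thesis
      using that ex scl_in by blast
  qed
  define e' where "e' = \<tau> e"
  have e': "e' \<in> K" "inn e' e' = 1"
    using e by (simp_all add: e'_def \<tau>_in \<tau>_self)
  define P where "P = {u \<in> K. inn u e = 0}"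
  have P: "u \<in> K" "inn u e = 0" "inn e u = 0" if "u \<in> P" for u
    using that inn_cnj[of e u] by (auto simp: P_def)
  have P_add: "u + v \<in> P" if "u \<in> P" "v \<in> P" for u v
    using that by (auto simp: P_def inn_simps add_in)
  have P_scl: "c \<cdot> u \<in> P" if "u \<in> P" for c u
    using that by (auto simp: P_def inn_simps scl_in)
  have "\<exists>w. w \<in> K \<and> inn w e' = 0 \<and> (\<exists>c. cmod c = 1 \<and> \<tau> (e + u) = c \<cdot> (e' + w))" if u: "u \<in> P" for u
  proof -
    \<comment> \<open>The component along e' has modulus |<e + u, e>| = 1, so dividing by it
      normalizes that component to 1.\<close>
    define c where "c = inn (\<tau> (e + u)) e'"
    have "cmod c = cmod (inn (e + u) e)"
      unfolding c_def e'_def using P[OF u] e by (simp add: \<tau> add_in)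
    then have c: "cmod c = 1"
      using P[OF u] e by (simp add: inn_simps)
    then have "c \<noteq> 0" by auto
    define w where "w = (1 / c) \<cdot> \<tau> (e + u) - e'"
    have "w \<in> K"
      unfolding w_def using P[OF u] e e' by (intro diff_in scl_in \<tau>_in add_in)
    moreover have "inn w e' = 0"
      using \<open>c \<noteq> 0\<close> e' by (simp add: w_def inn_simps c_def)
    moreover have "\<tau> (e + u) = c \<cdot> (e' + w)"
      using \<open>c \<noteq> 0\<close> by (simp add: w_def scl_scl scl_one)
    ultimately show ?thesis
      using c by blast
  qed
  then obtain \<sigma> where \<sigma>_in: "\<And>u. u \<in> P \<Longrightarrow> \<sigma> u \<in> K" and \<sigma>_e: "\<And>u. u \<in> P \<Longrightarrow> inn (\<sigma> u) e' = 0"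
    and \<sigma>_\<tau>: "\<And>u. u \<in> P \<Longrightarrow> \<exists>c. cmod c = 1 \<and> \<tau> (e + u) = c \<cdot> (e' + \<sigma> u)"
    by metis
  have e_\<sigma>: "inn e' (\<sigma> u) = 0" if "u \<in> P" for u
    using \<sigma>_e[OF that] inn_cnj[of e' "\<sigma> u"] by simp
  have mod_one: "cmod (1 + inn (\<sigma> u) (\<sigma> v)) = cmod (1 + inn u v)" if u: "u \<in> P" and v: "v \<in> P" for u v
  proof -
    obtain c d where c: "cmod c = 1" "\<tau> (e + u) = c \<cdot> (e' + \<sigma> u)" "cmod d = 1" "\<tau> (e + v) = d \<cdot> (e' + \<sigma> v)"
      using \<sigma>_\<tau> u v by metis
    have "cmod (inn (\<tau> (e + u)) (\<tau> (e + v))) = cmod (inn (e + u) (e + v))"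
      using u v e by (simp add: \<tau> add_in P)
    moreover have "inn (e + u) (e + v) = 1 + inn u v"
      using u v by (simp add: inn_simps e P)
    moreover have "inn (\<tau> (e + u)) (\<tau> (e + v)) = c * cnj d * (1 + inn (\<sigma> u) (\<sigma> v))"
      using u v by (simp add: c inn_simps e' \<sigma>_e e_\<sigma> algebra_simps)
    ultimately show ?thesis
      using c by (simp add: norm_mult)
  qed
  have \<sigma>_self: "inn (\<sigma> u) (\<sigma> u) = inn u u" if "u \<in> P" for u
  proof -
    have "1 + inn x x = of_real (1 + cmod (inn x x))" for x
      using inn_self[of x] by simp
    then have "cmod (1 + inn x x) = 1 + cmod (inn x x)" for x
      by (smt (verit) norm_ge_zero norm_of_real)
    then show ?thesis
      using mod_one[OF that that] by (intro inn_self_eqI) simp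
  qed
  \<comment> \<open>As \<tau> u is orthogonal to e', pairing it with \<sigma> u has the same modulus
    as pairing it with \<tau> (e + u), namely <u,u>.\<close>
  have \<sigma>_phase: "\<exists>c. cmod c = 1 \<and> \<sigma> u = c \<cdot> \<tau> u" if u: "u \<in> P" for u
  proof (rule Cauchy_Schwarz_eq_phase)
    obtain c where c: "cmod c = 1" "\<tau> (e + u) = c \<cdot> (e' + \<sigma> u)"
      using \<sigma>_\<tau> u by blast
    have "cmod (inn (\<tau> u) e') = cmod (inn u e)"
      unfolding e'_def using u e by (simp add: \<tau> P)
    then have "inn (\<tau> u) e' = 0"
      using u P by simp
    then have "cmod (inn (\<tau> u) (\<sigma> u)) = cmod (inn (\<tau> u) (\<tau> (e + u)))"
      by (simp add: c inn_simps norm_mult)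
    also have "\<dots> = cmod (inn u (e + u))"
      using u e by (simp add: \<tau> add_in P)
    also have "\<dots> = cmod (inn (\<tau> u) (\<tau> u))"
      using u by (simp add: inn_simps P \<tau>_self)
    finally show "cmod (inn (\<tau> u) (\<sigma> u)) = cmod (inn (\<tau> u) (\<tau> u))" .
  qed (use u in \<open>auto simp: P \<tau>_in \<sigma>_in \<tau>_self \<sigma>_self\<close>)
  have mod_eq: "cmod (inn (\<sigma> u) (\<sigma> v)) = cmod (inn u v)" if u: "u \<in> P" and v: "v \<in> P" for u v
  proof -
    obtain c d where "cmod c = 1" "\<sigma> u = c \<cdot> \<tau> u" "cmod d = 1" "\<sigma> v = d \<cdot> \<tau> v"
      using \<sigma>_phase u v by metis
    then show ?thesis
      using u v by (simp add: inn_simps norm_mult \<tau> P)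
  qed
  have Re_eq: "Re (inn (\<sigma> u) (\<sigma> v)) = Re (inn u v)" if u: "u \<in> P" and v: "v \<in> P" for u v
  proof -
    \<comment> \<open>The moduli of z and 1 + z together determine Re z.\<close>
    have "(cmod (1 + z))\<^sup>2 = 1 + 2 * Re z + (cmod z)\<^sup>2" for z
      unfolding cmod_power2 by (simp add: power2_eq_square algebra_simps)
    then show ?thesis
      using mod_one[OF u v] mod_eq[OF u v] by (smt (verit))
  qed
  have \<sigma>_add: "\<sigma> (u + v) = \<sigma> u + \<sigma> v" if u: "u \<in> P" and v: "v \<in> P" for u v
  proof -
    \<comment> \<open>The squared norm of the defect expands into real parts that \<sigma>
      preserves, so it equals the one for (u + v) - (u + v). Real homogeneity below follows the same
      way.\<close>
    have "Re (inn (\<sigma> (u + v) - (\<sigma> u + \<sigma> v)) (\<sigma> (u + v) - (\<sigma> u + \<sigma> v))) = 0"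
      using u v by (simp add: inn_simps Re_eq P_add)
    then have "\<sigma> (u + v) - (\<sigma> u + \<sigma> v) = 0"
      using u v by (intro Re_inn_eq_0 diff_in \<sigma>_in add_in P_add)
    then show ?thesis by simp
  qed
  have \<sigma>_real: "\<sigma> (of_real r \<cdot> u) = of_real r \<cdot> \<sigma> u" if u: "u \<in> P" for u r
  proof -
    have "Re (inn (\<sigma> (of_real r \<cdot> u) - of_real r \<cdot> \<sigma> u) (\<sigma> (of_real r \<cdot> u) - of_real r \<cdot> \<sigma> u)) = 0"
      using u by (simp add: inn_simps Re_eq P_scl[OF u])
    then have "\<sigma> (of_real r \<cdot> u) - of_real r \<cdot> \<sigma> u = 0"
      using u by (intro Re_inn_eq_0 diff_in \<sigma>_in scl_in P_scl)
    then show ?thesis by simp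
  qed
  have \<sigma>_i: "\<sigma> (\<i> \<cdot> u) = \<i> \<cdot> \<sigma> u \<or> \<sigma> (\<i> \<cdot> u) = (- \<i>) \<cdot> \<sigma> u" if u: "u \<in> P" for u
  proof -
    have iu: "\<i> \<cdot> u \<in> P"
      using P_scl u by blast
    have "\<exists>c. cmod c = 1 \<and> \<sigma> (\<i> \<cdot> u) = c \<cdot> \<sigma> u"
      using u iu by (intro Cauchy_Schwarz_eq_phase) (simp_all add: \<sigma>_in \<sigma>_self mod_eq inn_simps norm_mult)
    then obtain c where c: "cmod c = 1" "\<sigma> (\<i> \<cdot> u) = c \<cdot> \<sigma> u"
      by blast
    show ?thesis
    proof (cases "\<sigma> u = 0")
      case False
      then have "inn (\<sigma> u) (\<sigma> u) \<noteq> 0"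
        using inn_eq_0 \<sigma>_in u by blast
      then have "Re (inn u u) \<noteq> 0"
        using u by (simp add: \<sigma>_self complex_eq_iff Im_inn_self)
      \<comment> \<open><\<i> u, u> is purely imaginary, so the phase c has real part 0 and must be
        \<i> or -\<i>.\<close>
      moreover have "Re (inn (\<sigma> (\<i> \<cdot> u)) (\<sigma> u)) = Re (inn (\<i> \<cdot> u) u)"
        using Re_eq iu u by blast
      then have "Re c * Re (inn u u) = 0"
        using u by (simp add: c inn_simps \<sigma>_self Im_inn_self)
      ultimately have "Re c = 0"
        by simp
      then have "c = \<i> \<or> c = - \<i>"
        using c(1) by (auto simp: complex_eq_iff cmod_def)
      then show ?thesis
        using c by auto
    qed (simp add: c)
  qed
  \<comment> \<open>If u and v had opposite signs, either sign at u + v would force \<sigma> u = 0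
    or \<sigma> v = 0, but a vector with zero image satisfies both equations.\<close>
  have "(\<forall>u\<in>P. \<sigma> (\<i> \<cdot> u) = \<i> \<cdot> \<sigma> u) \<or> (\<forall>u\<in>P. \<sigma> (\<i> \<cdot> u) = (- \<i>) \<cdot> \<sigma> u)"
  proof (rule ccontr)
    assume "\<not> ?thesis"
    then obtain u v where u: "u \<in> P" "\<sigma> (\<i> \<cdot> u) \<noteq> \<i> \<cdot> \<sigma> u" and v: "v \<in> P" "\<sigma> (\<i> \<cdot> v) \<noteq> (- \<i>) \<cdot> \<sigma> v"
      by blast
    then have u': "\<sigma> (\<i> \<cdot> u) = (- \<i>) \<cdot> \<sigma> u" and v': "\<sigma> (\<i> \<cdot> v) = \<i> \<cdot> \<sigma> v"
      using \<sigma>_i by blast+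
    have iw: "\<sigma> (\<i> \<cdot> (u + v)) = (- \<i>) \<cdot> \<sigma> u + \<i> \<cdot> \<sigma> v"
      using u v P_scl[OF u(1)] P_scl[OF v(1)] by (simp add: scl_add \<sigma>_add u' v')
    have "2 * \<i> = \<i> + \<i>" by simp
    then have two: "(2 * \<i>) \<cdot> x = \<i> \<cdot> x + \<i> \<cdot> x" for x
      by (simp only: add_scl)
    have "\<sigma> u = 0 \<or> \<sigma> v = 0"
      using \<sigma>_i[OF P_add[OF u(1) v(1)]]
    proof
      assume "\<sigma> (\<i> \<cdot> (u + v)) = \<i> \<cdot> \<sigma> (u + v)"
      then have "\<i> \<cdot> \<sigma> u = - (\<i> \<cdot> \<sigma> u)"
        unfolding iw using u v by (simp add: \<sigma>_add scl_add minus_scl)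
      then have "(2 * \<i>) \<cdot> \<sigma> u = 0"
        unfolding two by (simp add: eq_neg_iff_add_eq_0)
      then have "(1 / (2 * \<i>)) \<cdot> (2 * \<i>) \<cdot> \<sigma> u = 0"
        by (simp only: scl_zero)
      then show ?thesis
        by (simp add: scl_scl scl_one)
    next
      assume "\<sigma> (\<i> \<cdot> (u + v)) = (- \<i>) \<cdot> \<sigma> (u + v)"
      then have "\<i> \<cdot> \<sigma> v = - (\<i> \<cdot> \<sigma> v)"
        unfolding iw using u v by (simp add: \<sigma>_add scl_add minus_scl)
      then have "(2 * \<i>) \<cdot> \<sigma> v = 0"
        unfolding two by (simp add: eq_neg_iff_add_eq_0)
      then have "(1 / (2 * \<i>)) \<cdot> (2 * \<i>) \<cdot> \<sigma> v = 0"
        by (simp only: scl_zero)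
      then show ?thesis
        by (simp add: scl_scl scl_one)
    qed
    then show False
      using u v u' v' by auto
  qed
  then obtain \<kappa> where \<kappa>: "\<kappa> = id \<or> \<kappa> = cnj" and \<kappa>_i: "\<And>u. u \<in> P \<Longrightarrow> \<sigma> (\<i> \<cdot> u) = \<kappa> \<i> \<cdot> \<sigma> u"
    by (metis complex_cnj_i id_apply)
  have \<kappa>_simps: "\<kappa> (c + d) = \<kappa> c + \<kappa> d" "\<kappa> (c - d) = \<kappa> c - \<kappa> d" "\<kappa> (c * d) = \<kappa> c * \<kappa> d" "\<kappa> (cnj c) = cnj (\<kappa> c)"
      "cmod (\<kappa> c) = cmod c" "\<kappa> (\<kappa> c) = c" "Re (\<kappa> c) = Re c" "\<kappa> (of_real r) = of_real r"
      "\<kappa> 1 = 1" "\<kappa> 0 = 0" for c d r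
    using \<kappa> by auto
  have \<sigma>_scl: "\<sigma> (c \<cdot> u) = \<kappa> c \<cdot> \<sigma> u" if u: "u \<in> P" for c u
  proof -
    have c: "c = of_real (Re c) + of_real (Im c) * \<i>"
      by (simp add: complex_eq_iff)
    have "\<sigma> (c \<cdot> u) = \<sigma> (of_real (Re c) \<cdot> u + of_real (Im c) \<cdot> \<i> \<cdot> u)"
      by (subst c) (simp only: add_scl scl_scl)
    also have "\<dots> = of_real (Re c) \<cdot> \<sigma> u + of_real (Im c) \<cdot> \<kappa> \<i> \<cdot> \<sigma> u"
      using P_scl u by (simp add: \<sigma>_add \<sigma>_real \<kappa>_i)
    also have "\<dots> = (of_real (Re c) + of_real (Im c) * \<kappa> \<i>) \<cdot> \<sigma> u"
      by (simp only: add_scl scl_scl)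
    also have "of_real (Re c) + of_real (Im c) * \<kappa> \<i> = \<kappa> c"
      by (subst (3) c) (simp only: \<kappa>_simps)
    finally show ?thesis .
  qed
  have \<sigma>_inn: "inn (\<sigma> u) (\<sigma> v) = \<kappa> (inn u v)" if u: "u \<in> P" and v: "v \<in> P" for u v
  proof (rule complex_eqI)
    show "Re (inn (\<sigma> u) (\<sigma> v)) = Re (\<kappa> (inn u v))"
      using u v by (simp add: Re_eq \<kappa>_simps)
    \<comment> \<open>Preservation of real parts at \<i> u recovers the imaginary part.\<close>
    have "Re (\<kappa> \<i> * inn (\<sigma> u) (\<sigma> v)) = Re (\<i> * inn u v)"
      using Re_eq[OF P_scl[OF u] v, of \<i>] u by (simp add: \<sigma>_scl inn_simps)
    then show "Im (inn (\<sigma> u) (\<sigma> v)) = Im (\<kappa> (inn u v))"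
      using \<kappa> by auto
  qed
  define pr where "pr x = x - inn x e \<cdot> e" for x
  have pr_P: "pr x \<in> P" if "x \<in> K" for x
    using that e by (auto simp: pr_def P_def inn_simps diff_in scl_in)
  have pr_add: "pr (x + y) = pr x + pr y" for x y
    by (simp add: pr_def inn_simps add_scl)
  have pr_scl: "pr (c \<cdot> x) = c \<cdot> pr x" for c x
    by (simp add: pr_def inn_simps scl_diff scl_scl)
  have pr_split: "x = inn x e \<cdot> e + pr x" for x
    by (simp add: pr_def)
  have inn_pr: "inn x y = inn x e * cnj (inn y e) + inn (pr x) (pr y)" if "x \<in> K" "y \<in> K" for x y
    using P[OF pr_P[OF that(1)]] P[OF pr_P[OF that(2)]] e
    by (subst pr_split[of x], subst pr_split[of y]) (simp add: inn_simps)
  \<comment> \<open>V is the \<kappa>-linear extension of \<sigma> that sends e to e'.\<close>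
  define V where "V x = \<kappa> (inn x e) \<cdot> e' + \<sigma> (pr x)" for x
  show thesis
  proof (rule that[OF \<kappa>])
    show V_in: "V x \<in> K" if "x \<in> K" for x
      using that e' by (auto simp: V_def add_in scl_in \<sigma>_in pr_P)
    show "V (x + y) = V x + V y" if "x \<in> K" "y \<in> K" for x y
      using that by (simp add: V_def inn_simps \<kappa>_simps add_scl pr_add \<sigma>_add pr_P)
    show "V (c \<cdot> x) = \<kappa> c \<cdot> V x" if "x \<in> K" for c x
      using that by (simp add: V_def inn_simps \<kappa>_simps scl_add pr_scl \<sigma>_scl pr_P scl_scl)
    show V_inn: "inn (V x) (V y) = \<kappa> (inn x y)" if "x \<in> K" "y \<in> K" for x y
      using that pr_P[OF that(1)] pr_P[OF that(2)]
      by (simp add: V_def inn_simps e' \<sigma>_e e_\<sigma> \<sigma>_inn inn_pr[of x y] \<kappa>_simps)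
    show "\<exists>c. cmod c = 1 \<and> \<tau> x = c \<cdot> V x" if x: "x \<in> K" for x
    proof (rule Cauchy_Schwarz_eq_phase)
      show "inn (V x) (V x) = inn (\<tau> x) (\<tau> x)"
        using x by (intro inn_self_eqI) (simp add: V_inn \<tau> \<kappa>_simps)
      define l where "l = inn x e"
      \<comment> \<open>Off the hyperplane l = 0, x is a multiple l (e + u) with u in P, and V x is
        a multiple of \<tau> (e + u) by a scalar of modulus |l|.\<close>
      have "cmod (inn (V x) (\<tau> x)) = cmod (inn x x)"
      proof (cases "l = 0")
        case True
        then have "x \<in> P" "V x = \<sigma> x"
          using x by (auto simp: P_def l_def V_def pr_def \<kappa>_simps)
        then obtain c where "cmod c = 1" "V x = c \<cdot> \<tau> x"
          using \<sigma>_phase by metis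
        then show ?thesis
          using x by (simp add: inn_simps norm_mult \<tau>)
      next
        case False
        define u where "u = (1 / l) \<cdot> pr x"
        have u: "u \<in> P"
          using P_scl pr_P x by (simp add: u_def)
        have "pr x = l \<cdot> u"
          using False by (simp add: u_def scl_scl scl_one)
        then have Vx: "V x = \<kappa> l \<cdot> (e' + \<sigma> u)" and xl: "x = l \<cdot> (e + u)"
          using pr_split[of x] u by (simp_all add: V_def l_def \<sigma>_scl scl_add)
        obtain c where c: "cmod c = 1" "\<tau> (e + u) = c \<cdot> (e' + \<sigma> u)"
          using \<sigma>_\<tau> u by blast
        have "cmod (inn (V x) (\<tau> x)) = cmod l * cmod (inn (\<tau> (e + u)) (\<tau> x))"
          by (simp add: Vx c inn_scl_left norm_mult \<kappa>_simps)
        also have "\<dots> = cmod l * cmod (inn (e + u) x)"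
          using x u e by (simp add: \<tau> add_in P)
        also have "\<dots> = cmod (inn x x)"
          by (subst (2) xl) (simp add: inn_scl_left norm_mult)
        finally show ?thesis .
      qed
      then show "cmod (inn (V x) (\<tau> x)) = cmod (inn (V x) (V x))"
        using x by (simp add: V_inn \<kappa>_simps)
    qed (use x in \<open>auto simp: V_in \<tau>_in\<close>)
  qed
qed

end

subsection \<open>Coordinates of a Hilbert module\<close>

definition munit :: "'n \<Rightarrow> 'n \<Rightarrow> 'n::finite cmat" where
  "munit i j = (\<chi> a b. if a = i \<and> b = j then 1 else 0)"

lemma munit_mult_nth: "(munit i j ** a) $ p $ q = (if p = i then a $ j $ q else 0)"
proof -
  have "(munit i j ** a) $ p $ q = (\<Sum>l\<in>UNIV. if l = j then (if p = i then a $ l $ q else 0) else 0)"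
    unfolding matrix_matrix_mult_def vec_lambda_beta by (intro sum.cong) (auto simp: munit_def)
  then show ?thesis by simp
qed

lemma madj_munit: "madj (munit i j) = munit j i"
  by (auto simp: vec_eq_iff munit_def)

lemma mult_munit_nth: "((a :: 'n::finite cmat) ** munit i j) $ p $ q = (if q = j then a $ p $ i else 0)"
proof -
  have "a ** munit i j = madj (munit j i ** madj a)"
    by (simp add: madj_mult madj_munit)
  then show ?thesis
    by (simp add: munit_mult_nth)
qed

lemma munit_munit: "munit i j ** munit j' l = (if j = j' then munit i l else 0)"
  by (auto simp: vec_eq_iff munit_mult_nth) (auto simp: munit_def)

text \<open>E_ki a carries row i of a to row k. Expanding that row is what lets
  \<open>coord_act\<close> read as a matrix applied to a column of coordinates.\<close>

lemma munit_mult_expand: "munit k i ** a = (\<Sum>j\<in>UNIV. mat (a $ i $ j) ** munit k j)"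
proof -
  have "(\<Sum>j\<in>UNIV. mat (a $ i $ j) ** munit k j) $ p $ q = (munit k i ** a) $ p $ q" for p q
  proof -
    have "(\<Sum>j\<in>UNIV. mat (a $ i $ j) ** munit k j) $ p $ q
        = (\<Sum>j\<in>UNIV. if q = j then (if p = k then a $ i $ j else 0) else 0)"
      by (auto simp: mult_munit_nth mat_def intro!: sum.cong)
    then show ?thesis
      by (simp add: munit_mult_nth)
  qed
  then show ?thesis
    by (simp add: vec_eq_iff)
qed

lemma sum_munit_diag: "(\<Sum>i\<in>UNIV. munit i i) = mat 1"
proof -
  have "(\<Sum>i\<in>UNIV. munit i i) $ p $ q = mat 1 $ p $ q" for p q :: 'a
  proof -
    have "(\<Sum>i\<in>UNIV. munit i i) $ p $ q = (\<Sum>i\<in>UNIV. if p = i then (if p = q then 1 else 0) else 0)"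
      unfolding sum_component by (intro sum.cong) (auto simp: munit_def)
    then show ?thesis
      by (simp add: mat_def)
  qed
  then show ?thesis
    by (simp add: vec_eq_iff)
qed

lemma mat_mult_nth: "(mat c ** a) $ p $ q = c * (a :: 'n::finite cmat) $ p $ q"
proof -
  have "(mat c ** a) $ p $ q = (\<Sum>l\<in>UNIV. if p = l then c * a $ l $ q else 0)"
    unfolding matrix_matrix_mult_def vec_lambda_beta by (intro sum.cong) (auto simp: mat_def)
  then show ?thesis by simp
qed

lemma mat_mult: "mat c ** mat d = (mat (c * d :: complex) :: 'n::finite cmat)"
  by (simp add: vec_eq_iff mat_mult_nth) (simp add: mat_def)

lemma mat_commute: "mat c ** a = (a :: 'n::finite cmat) ** mat c"
proof -
  have "(a ** mat c) $ p $ q = c * a $ p $ q" for p q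
  proof -
    have "(a ** mat c) $ p $ q = (\<Sum>l\<in>UNIV. if l = q then c * a $ p $ l else 0)"
      unfolding matrix_matrix_mult_def vec_lambda_beta by (intro sum.cong) (auto simp: mat_def)
    then show ?thesis by simp
  qed
  then show ?thesis
    by (simp add: vec_eq_iff mat_mult_nth)
qed

locale hilbert_mod =
  fixes act :: "'n::finite cmat \<Rightarrow> 'h::ab_group_add \<Rightarrow> 'h"
    and ip :: "'h \<Rightarrow> 'h \<Rightarrow> 'n cmat"
    and k :: 'n
  assumes hilbert_module: "hilbert_module act ip"
begin

lemma act_mult: "act (a ** b) f = act a (act b f)"
  and act_one: "act (mat 1) f = f"
  and act_add: "act a (f + g) = act a f + act a g"
  and add_act: "act (a + b) f = act a f + act b f"
  and ip_add_left: "ip (f + g) h = ip f h + ip g h"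
  and ip_act_left: "ip (act a f) g = a ** ip f g"
  and ip_commute: "ip g f = madj (ip f g)"
  and ip_pos: "mpos (ip f f)"
  and ip_eq_0_iff: "ip f f = 0 \<longleftrightarrow> f = 0"
proof -
  note hm = hilbert_module[unfolded hilbert_module_def]
  show "act (a ** b) f = act a (act b f)"
    using hm[THEN conjunct1] by blast
  show "act (mat 1) f = f"
    using hm[THEN conjunct2, THEN conjunct1] by blast
  show "act a (f + g) = act a f + act a g"
    using hm[THEN conjunct2, THEN conjunct2, THEN conjunct1] by blast
  show "act (a + b) f = act a f + act b f"
    using hm[THEN conjunct2, THEN conjunct2, THEN conjunct2, THEN conjunct1] by blast
  show "ip (f + g) h = ip f h + ip g h"
    using hm[THEN conjunct2, THEN conjunct2, THEN conjunct2, THEN conjunct2, THEN conjunct1] by blast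
  show "ip (act a f) g = a ** ip f g"
    using hm[THEN conjunct2, THEN conjunct2, THEN conjunct2, THEN conjunct2, THEN conjunct2, THEN conjunct1] by blast
  show "ip g f = madj (ip f g)"
    using hm[THEN conjunct2, THEN conjunct2, THEN conjunct2, THEN conjunct2, THEN conjunct2, THEN conjunct2, THEN conjunct1] by blast
  show "mpos (ip f f)"
    using hm[THEN conjunct2, THEN conjunct2, THEN conjunct2, THEN conjunct2, THEN conjunct2, THEN conjunct2, THEN conjunct2, THEN conjunct1] by blast
  show "ip f f = 0 \<longleftrightarrow> f = 0"
    using hm[THEN conjunct2, THEN conjunct2, THEN conjunct2, THEN conjunct2, THEN conjunct2, THEN conjunct2, THEN conjunct2, THEN conjunct2, THEN conjunct1] by blast
qed

lemma ip_act_right: "ip f (act a g) = ip f g ** madj a"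
  by (metis ip_act_left ip_commute madj_madj madj_mult)

lemma act_0_left [simp]: "act 0 f = 0"
  using add_act[of 0 0 f] by simp

lemma act_0_right [simp]: "act a 0 = 0"
  using act_add[of a 0 0] by simp

lemma ip_zero: "ip 0 g = 0" "ip f 0 = 0"
  using ip_act_left[of 0 0 g] ip_act_right[of f 0 0] by (simp_all add: vec_eq_iff matrix_matrix_mult_def)

lemma act_sum_left: "act (\<Sum>i\<in>A. F i) f = (\<Sum>i\<in>A. act (F i) f)"
  by (induction A rule: infinite_finite_induct) (simp_all add: add_act)

lemma act_sum_right: "act a (\<Sum>i\<in>A. F i) = (\<Sum>i\<in>A. act a (F i))"
  by (induction A rule: infinite_finite_induct) (simp_all add: act_add)

text \<open>The module is identified with the \<open>d\<close>-tuples of vectors of the Hilbert space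
  \<open>K = E\<^sub>k\<^sub>k \<H>\<close>, on which the inner product is the \<open>(k,k)\<close> entry of \<open>ip\<close>.\<close>

definition coord :: "'n \<Rightarrow> 'h \<Rightarrow> 'h" where
  "coord i f = act (munit k i) f"

definition K :: "'h set" where
  "K = {x. act (munit k k) x = x}"

definition inn :: "'h \<Rightarrow> 'h \<Rightarrow> complex" where
  "inn x y = ip x y $ k $ k"

lemma coord_in_K: "coord i f \<in> K"
  by (simp add: K_def coord_def act_mult[symmetric] munit_munit)

lemma coord_in: "x \<in> K \<Longrightarrow> coord i x = (if i = k then x else 0)"
proof -
  assume "x \<in> K"
  then have "coord i x = act (munit k i) (act (munit k k) x)"
    by (simp add: K_def coord_def)
  then show ?thesis
    using \<open>x \<in> K\<close> by (simp add: act_mult[symmetric] munit_munit K_def)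
qed

text \<open>The (k,k) entry of E_ki a E_jk is the (i,j) entry of a.\<close>

lemma ip_nth: "ip f g $ i $ j = inn (coord i f) (coord j g)"
  by (simp add: inn_def coord_def ip_act_left ip_act_right madj_munit munit_mult_nth mult_munit_nth)

lemma sum_coord: "f = (\<Sum>i\<in>UNIV. act (munit i k) (coord i f))"
proof -
  have "(\<Sum>i\<in>UNIV. act (munit i k) (coord i f)) = act (\<Sum>i\<in>UNIV. munit i i) f"
    by (simp add: coord_def act_mult[symmetric] munit_munit act_sum_left)
  then show ?thesis
    by (simp add: sum_munit_diag act_one)
qed

lemma coord_eqI:
  assumes "\<And>i. coord i f = coord i g"
  shows "f = g"
proof -
  have "(\<Sum>i\<in>UNIV. act (munit i k) (coord i f)) = (\<Sum>i\<in>UNIV. act (munit i k) (coord i g))"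
    by (simp add: assms)
  then show ?thesis
    by (simp only: sum_coord[symmetric])
qed

lemma coord_sum:
  assumes "\<And>i. x i \<in> K"
  shows "coord j (\<Sum>i\<in>UNIV. act (munit i k) (x i)) = x j"
proof -
  have "coord j (\<Sum>i\<in>UNIV. act (munit i k) (x i)) = (\<Sum>i\<in>UNIV. if j = i then x i else 0)"
    unfolding coord_def act_sum_right
    using assms by (intro sum.cong) (auto simp: act_mult[symmetric] munit_munit K_def)
  then show ?thesis by simp
qed

lemma coord_add: "coord i (f + g) = coord i f + coord i g"
  by (simp add: coord_def act_add)

lemma coord_act: "coord i (act a f) = (\<Sum>j\<in>UNIV. act (mat (a $ i $ j)) (coord j f))"
  unfolding coord_def act_mult[symmetric] munit_mult_expand by (simp add: act_sum_left)

lemma coord_mat: "coord i (act (mat c) f) = act (mat c) (coord i f)"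
  by (simp add: coord_def act_mult[symmetric] mat_commute)

sublocale complex_inner_subspace K "\<lambda>c. act (mat c)" inn
proof
  fix x y z :: 'h and c d :: complex
  show "x + y \<in> K" if "x \<in> K" "y \<in> K"
    using that by (simp add: K_def act_add)
  show "act (mat c) x \<in> K" if "x \<in> K"
    using that coord_mat[of k c x] by (simp add: K_def coord_def)
  show "act (mat c) (x + y) = act (mat c) x + act (mat c) y"
    by (rule act_add)
  have "mat (c + d) = mat c + (mat d :: 'n cmat)"
    by (simp add: vec_eq_iff mat_def)
  then show "act (mat (c + d)) x = act (mat c) x + act (mat d) x"
    by (simp add: add_act)
  show "act (mat c) (act (mat d) x) = act (mat (c * d)) x"
    by (simp add: act_mult[symmetric] mat_mult)
  show "act (mat 1) x = x"
    by (rule act_one)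
  show "inn (x + y) z = inn x z + inn y z"
    by (simp add: inn_def ip_add_left)
  show "inn (act (mat c) x) y = c * inn x y"
    by (simp add: inn_def ip_act_left mat_mult_nth)
  show "inn y x = cnj (inn x y)"
    by (simp add: inn_def ip_commute[of y x])
  show "0 \<le> Re (inn x x)"
    unfolding inn_def by (rule mpos_diag[OF ip_pos])
  show "x = 0" if "x \<in> K" "inn x x = 0"
  proof -
    \<comment> \<open>All coordinates of x other than the k-th vanish, so (k,k) is the only entry of
      [x,x] that could be nonzero.\<close>
    have "ip x x $ i $ j = 0" for i j
      using that by (simp add: ip_nth coord_in) (simp add: inn_def ip_zero)
    then show ?thesis
      by (simp add: vec_eq_iff flip: ip_eq_0_iff)
  qed
qed

section \<open>Gram products and the reconstruction of \<open>T\<close>\<close>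

lemma gram_nth:
  "(ip g f ** ip f g) $ i $ j = (\<Sum>l\<in>UNIV. inn (coord i g) (coord l f) * inn (coord l f) (coord j g))"
  by (simp add: matrix_matrix_mult_def ip_nth)

text \<open>Only the k-th coordinate of x survives, so the sum collapses to a rank-one
  expression.\<close>

lemma gram_nth_K:
  assumes "x \<in> K"
  shows "(ip g x ** ip x g) $ i $ j = inn (coord i g) x * inn x (coord j g)"
proof -
  have "(ip g x ** ip x g) $ i $ j
      = (\<Sum>l\<in>UNIV. if l = k then inn (coord i g) x * inn x (coord j g) else 0)"
    unfolding gram_nth using assms by (intro sum.cong) (auto simp: coord_in)
  then show ?thesis by simp
qed

lemma coord_zero [simp]: "coord i 0 = 0"
  by (simp add: coord_def)

text \<open>Expressing membership through Gram products alone shows that \<open>T\<close> preserves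
  and reflects \<open>K\<close>. For the converse, the test vector f_i produces the entry
  <f_i,f_i>^2.\<close>

lemma in_K_iff_gram: "f \<in> K \<longleftrightarrow> (\<forall>g. \<forall>i. i \<noteq> k \<longrightarrow> (ip f g ** ip g f) $ i $ i = 0)"
proof
  assume "f \<in> K"
  then show "\<forall>g. \<forall>i. i \<noteq> k \<longrightarrow> (ip f g ** ip g f) $ i $ i = 0"
    by (simp add: gram_nth coord_in)
next
  assume *: "\<forall>g. \<forall>i. i \<noteq> k \<longrightarrow> (ip f g ** ip g f) $ i $ i = 0"
  have "coord i f = 0" if "i \<noteq> k" for i
  proof (rule inn_eq_0[OF coord_in_K])
    have "(ip f (coord i f) ** ip (coord i f) f) $ i $ i = 0"
      using * that by blast
    then show "inn (coord i f) (coord i f) = 0"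
      unfolding gram_nth_K[OF coord_in_K] by simp
  qed
  then have "coord i (coord k f) = coord i f" for i
    by (simp add: coord_in[OF coord_in_K])
  then have "coord k f = f"
    by (rule coord_eqI)
  then show "f \<in> K"
    using coord_in_K[of k f] by simp
qed

text \<open>Applying \<kappa> entrywise treats both cases at once: \<kappa> = \<open>id\<close>
  gives an A-unitary, while \<kappa> = \<open>cnj\<close> is confined to d = 1 and gives an
  antiunitary.\<close>

theorem exists_semilinear:
  fixes T :: "'h \<Rightarrow> 'h"
  assumes gh: "ip g h = mat 1"
    and surjT: "surj T"
    and gram: "\<And>f f'. ip (T f') (T f) ** ip (T f) (T f') = ip f' f ** ip f f'"
  obtains \<kappa> U \<phi> where "\<kappa> = id \<or> \<kappa> = cnj \<and> CARD('n) = 1" "bij U"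
    "\<And>f f'. U (f + f') = U f + U f'"
    "\<And>a f. U (act a f) = act (\<chi> i j. \<kappa> (a $ i $ j)) (U f)"
    "\<And>f f' i j. ip (U f) (U f') $ i $ j = \<kappa> (ip f f' $ i $ j)"
    "\<And>f. cmod (\<phi> f) = 1" "\<And>f. T f = act (mat (\<phi> f)) (U f)"
proof -
  have T_K: "T f \<in> K \<longleftrightarrow> f \<in> K" for f
    unfolding in_K_iff_gram by (metis gram surjT surjD)
  have gh_nth: "inn (coord i g) (coord j h) = (if i = j then 1 else 0)" for i j
    using ip_nth[of g h i j] by (simp add: gh mat_def)
  have mod_T: "cmod (inn (T x) (T y)) = cmod (inn x y)" if "x \<in> K" "y \<in> K" for x y
  proof -
    have "(ip y x ** ip x y) $ k $ k = (of_real (cmod (inn x y)))\<^sup>2" if "x \<in> K" "y \<in> K" for x y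
      using that inn_cnj[of y x] by (simp add: gram_nth_K coord_in mult.commute flip: complex_norm_square)
    then have "(of_real (cmod (inn (T x) (T y))))\<^sup>2 = (complex_of_real (cmod (inn x y)))\<^sup>2"
      using that T_K gram by metis
    then have "(cmod (inn (T x) (T y)))\<^sup>2 = (cmod (inn x y))\<^sup>2"
      by (metis of_real_eq_iff of_real_power)
    then show ?thesis
      by simp
  qed
  obtain \<kappa> V where \<kappa>: "\<kappa> = id \<or> \<kappa> = cnj" and V_in: "\<And>x. x \<in> K \<Longrightarrow> V x \<in> K"
    and V_add: "\<And>x y. x \<in> K \<Longrightarrow> y \<in> K \<Longrightarrow> V (x + y) = V x + V y"
    and V_scl: "\<And>c x. x \<in> K \<Longrightarrow> V (act (mat c) x) = act (mat (\<kappa> c)) (V x)"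
    and V_inn: "\<And>x y. x \<in> K \<Longrightarrow> y \<in> K \<Longrightarrow> inn (V x) (V y) = \<kappa> (inn x y)"
    and V_T: "\<And>x. x \<in> K \<Longrightarrow> \<exists>c. cmod c = 1 \<and> T x = act (mat c) (V x)"
  proof (rule wigner[of T "coord k g"], goal_cases)
    case (1 x)
    then show ?case
      by (simp add: T_K)
  next
    \<comment> \<open>g_k is nonzero because <g_k,h_k> = 1.\<close>
    case 4
    show ?case
      using gh_nth[of k k] by auto
  next
    case 5
    show ?case
      by (rule 5(1)[OF 5(2-)])
  qed (simp_all add: mod_T coord_in_K)
  have \<kappa>_simps: "\<kappa> (\<kappa> c) = c" "\<kappa> (c * d) = \<kappa> c * \<kappa> d" "cmod (\<kappa> c) = cmod c" "\<kappa> 0 = 0" for c d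
    using \<kappa> by auto
  have K0: "0 \<in> K"
    by (simp add: K_def)
  have V0: "V 0 = 0"
    using V_add[OF K0 K0] by simp
  have K_sum: "(\<Sum>i\<in>A. x i) \<in> K" if "\<And>i. x i \<in> K" for A :: "'n set" and x
    by (induction A rule: infinite_finite_induct) (simp_all add: K0 add_in that)
  have V_sum: "V (\<Sum>i\<in>A. x i) = (\<Sum>i\<in>A. V (x i))" if "\<And>i. x i \<in> K" for A :: "'n set" and x
    by (induction A rule: infinite_finite_induct) (simp_all add: V0 V_add K_sum that)
  \<comment> \<open>A preimage of y under T lies in \<open>K\<close>, and its phase is absorbed into
    the argument of V since \<kappa> is an involution.\<close>
  have V_onto: "\<exists>x\<in>K. V x = y" if "y \<in> K" for y
  proof -
    obtain f where f: "T f = y"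
      using surjT by (metis surjD)
    then have "f \<in> K"
      using T_K that by blast
    then obtain c where "y = act (mat c) (V f)"
      using V_T f by metis
    then have "y = V (act (mat (\<kappa> c)) f)"
      using \<open>f \<in> K\<close> by (simp add: V_scl \<kappa>_simps)
    then show ?thesis
      using \<open>f \<in> K\<close> scl_in by blast
  qed
  then obtain W where W: "\<And>y. y \<in> K \<Longrightarrow> W y \<in> K" "\<And>y. y \<in> K \<Longrightarrow> V (W y) = y"
    by metis
  define p where "p f i = W (coord i (T f))" for f i
  have p_in: "p f i \<in> K" and p: "V (p f i) = coord i (T f)" for f i
    by (simp_all add: p_def W coord_in_K)
  have rel: "inn (coord i f) x * inn x (coord j f) = \<kappa> (inn (p f i) x * inn x (p f j))"
    if x: "x \<in> K" for f i j x
  proof -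
    obtain c where c: "cmod c = 1" "T x = act (mat c) (V x)"
      using V_T x by blast
    then have cc: "c * cnj c = 1"
      by (simp flip: complex_norm_square)
    have "inn (coord i f) x * inn x (coord j f) = inn (coord i (T f)) (T x) * inn (T x) (coord j (T f))"
      using gram[of f x] gram_nth_K[OF x, of f i j] gram_nth_K[of "T x" "T f" i j] T_K x by metis
    \<comment> \<open>T x = c V x enters once in each slot, so its phase cancels.\<close>
    also have "\<dots> = (c * cnj c) * (inn (coord i (T f)) (V x) * inn (V x) (coord j (T f)))"
      by (simp add: c inn_scl_left inn_scl_right)
    also have "\<dots> = \<kappa> (inn (p f i) x * inn x (p f j))"
      using x by (simp add: cc p_in V_inn \<kappa>_simps flip: p)
    finally show ?thesis .
  qed
  have square: "inn y x * inn x y = of_real ((cmod (inn y x))\<^sup>2)" for x y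
    by (subst inn_cnj[of x y]) (simp only: complex_norm_square)
  have card: "CARD('n) = 1" if "\<kappa> = cnj"
  proof (rule ccontr)
    assume "CARD('n) \<noteq> 1"
    then obtain j where j: "j \<noteq> k"
      by (metis (full_types) UNIV_eq_I card_1_singleton_iff One_nat_def insertI1 singletonI)
    have "\<exists>c. cmod c = 1 \<and> p g i = act (mat c) (coord i g)" for i
    proof (rule phase_of_mod_eq)
      fix x assume "x \<in> K"
      then have "(cmod (inn (coord i g) x))\<^sup>2 = (cmod (inn (p g i) x))\<^sup>2"
        using rel[of x i g i] that unfolding square by (metis complex_cnj_complex_of_real of_real_eq_iff)
      then show "cmod (inn (coord i g) x) = cmod (inn (p g i) x)"
        by simp
    qed (auto simp: coord_in_K p_in)
    then obtain c where c: "\<And>i. p g i = act (mat (c i)) (coord i g)"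
      by metis
    define w where "w = cnj (c k * cnj (c j))"
    have w: "inn (coord k g) x * inn x (coord j g) = w * cnj (inn (coord k g) x * inn x (coord j g))" if "x \<in> K" for x
    proof -
      have "inn (p g k) x * inn x (p g j) = (c k * cnj (c j)) * (inn (coord k g) x * inn x (coord j g))"
        by (simp add: c inn_scl_left inn_scl_right)
      then show ?thesis
        using rel[OF that, of k g j] \<open>\<kappa> = cnj\<close> unfolding w_def by (metis complex_cnj_mult)
    qed
    have hg: "inn (coord i h) (coord j g) = (if i = j then 1 else 0)" for i j
      using inn_cnj[of "coord i h" "coord j g"] gh_nth[of j i] by auto
    \<comment> \<open>For x = h_k + l h_j the product <g_k,x> <x,g_j> equals l, so conjugation would
      be multiplication by a constant; l = 1 and l = \<i> refute this.\<close>
    have "l = w * cnj l" for l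
      using w[of "coord k h + act (mat l) (coord j h)"] j
      by (simp add: inn_simps gh_nth hg coord_in_K add_in scl_in)
    from this[of 1] this[of \<i>] show False
      by (simp add: complex_eq_iff)
  qed
  have "\<exists>c. cmod c = 1 \<and> (\<forall>i. p f i = act (mat c) (coord i f))" for f
  proof (rule common_phase)
    fix i j x assume x: "x \<in> K"
    show "inn (coord i f) x * inn x (coord j f) = inn (p f i) x * inn x (p f j)"
    proof (cases "\<kappa> = id")
      \<comment> \<open>With one index, i = j and the products are squared moduli, on which
        conjugation acts trivially.\<close>
      case False
      then have "\<kappa> = cnj" "CARD('n) = 1"
        using \<kappa> card by auto
      then have "i = j"
        by (metis card_1_singletonE UNIV_I singletonD)
      then show ?thesis
        using rel[OF x, of i f j] \<open>\<kappa> = cnj\<close> by (simp add: square)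
    qed (use rel[OF x] in simp)
  qed (auto simp: coord_in_K p_in)
  then obtain c where c: "\<And>f. cmod (c f) = 1" and pc: "\<And>f i. p f i = act (mat (c f)) (coord i f)"
    by metis
  define U where "U f = (\<Sum>i\<in>UNIV. act (munit i k) (V (coord i f)))" for f
  have coord_U: "coord i (U f) = V (coord i f)" for i f
    unfolding U_def by (intro coord_sum V_in coord_in_K)
  have U_add: "U (f + f') = U f + U f'" for f f'
    by (rule coord_eqI) (simp add: coord_U coord_add V_add coord_in_K)
  have U_act: "U (act a f) = act (\<chi> i j. \<kappa> (a $ i $ j)) (U f)" for a f
    by (rule coord_eqI) (simp add: coord_U coord_act V_sum V_scl coord_in_K scl_in)
  have U_ip: "ip (U f) (U f') $ i $ j = \<kappa> (ip f f' $ i $ j)" for f f' i j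
    by (simp add: ip_nth coord_U V_inn coord_in_K)
  have U_mat: "U (act (mat l) f) = act (mat (\<kappa> l)) (U f)" for l f
    by (rule coord_eqI) (simp add: coord_U coord_mat V_scl coord_in_K)
  have TU: "T f = act (mat (\<kappa> (c f))) (U f)" for f
    by (rule coord_eqI) (simp add: coord_mat coord_U V_scl coord_in_K pc flip: p)
  have "inj U"
  proof (rule injI)
    fix f f' assume "U f = U f'"
    then have "U (f - f') = 0"
      using U_add[of "f - f'" f'] by simp
    then have "\<kappa> (ip (f - f') (f - f') $ i $ j) = 0" for i j
      using U_ip[of "f - f'" "f - f'" i j] by (simp add: ip_zero)
    then have "ip (f - f') (f - f') $ i $ j = 0" for i j
      by (metis \<kappa>_simps(1,4))
    then have "f - f' = 0"
      by (simp add: vec_eq_iff flip: ip_eq_0_iff)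
    then show "f = f'" by simp
  qed
  moreover have "surj U"
  proof (rule surjI)
    \<comment> \<open>Since \<kappa> is an involution, T f is the image under U of f multiplied by
      the phase \<open>c f\<close>, so surjectivity passes from T to U.\<close>
    fix y show "U (act (mat (c (inv T y))) (inv T y)) = y"
      using TU[of "inv T y"] surj_f_inv_f[OF surjT, of y] by (simp add: U_mat)
  qed
  ultimately have "bij U"
    by (simp add: bij_def)
  show thesis
    by (rule that[of \<kappa> U "\<lambda>f. \<kappa> (c f)"]) (use \<kappa> card \<open>bij U\<close> U_add U_act U_ip TU c in \<open>auto simp: \<kappa>_simps\<close>)
qed

end

theorem theorem1:
  fixes act :: "'n::finite cmat \<Rightarrow> 'h::ab_group_add \<Rightarrow> 'h"
    and ip :: "'h \<Rightarrow> 'h \<Rightarrow> 'n cmat"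
    and T :: "'h \<Rightarrow> 'h"
  assumes HM: "hilbert_module act ip"
    and gh: "\<exists>g h. ip g h = mat 1"
    and surjT: "surj T"
    and presT: "\<forall>f f'. mabs (ip (T f) (T f')) = mabs (ip f f')"
  shows "(CARD('n) > 1 \<longrightarrow>
            (\<exists>U \<phi>. A_unitary act ip U \<and> phase_function \<phi> \<and>
                   (\<forall>f. T f = act (mat (\<phi> f)) (U f)))) \<and>
         (CARD('n) = 1 \<longrightarrow>
            (\<exists>U \<phi>. (unitary_op act ip U \<or> antiunitary_op act ip U) \<and> phase_function \<phi> \<and>
                   (\<forall>f. T f = act (mat (\<phi> f)) (U f))))"
proof -
  \<comment> \<open>Any index can serve as \<open>k\<close>; \<open>undefined\<close> names
    one.\<close>
  interpret hilbert_mod act ip undefined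
    by unfold_locales (rule HM)
  have gram: "ip (T f') (T f) ** ip (T f) (T f') = ip f' f ** ip f f'" for f f'
    using presT mabs_square ip_commute by metis
  obtain g h where g: "ip g h = mat 1"
    using gh by blast
  obtain \<kappa> U \<phi> where \<kappa>: "\<kappa> = id \<or> \<kappa> = cnj \<and> CARD('n) = 1"
    and U: "bij U" "\<And>f f'. U (f + f') = U f + U f'"
      "\<And>a f. U (act a f) = act (\<chi> i j. \<kappa> (a $ i $ j)) (U f)"
      "\<And>f f' i j. ip (U f) (U f') $ i $ j = \<kappa> (ip f f' $ i $ j)"
    and \<phi>: "\<And>f. cmod (\<phi> f) = 1" "\<And>f. T f = act (mat (\<phi> f)) (U f)"
  proof (rule exists_semilinear[OF g surjT gram], goal_cases)
    case 1
    show ?case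
      by (rule 1(1)[OF 1(2-)])
  qed
  have ph: "phase_function \<phi> \<and> (\<forall>f. T f = act (mat (\<phi> f)) (U f))"
    using \<phi> by (simp add: phase_function_def)
  show ?thesis
    using \<kappa>
  proof
    assume id: "\<kappa> = id"
    have "A_unitary act ip U" "unitary_op act ip U"
      using U unfolding A_unitary_def unitary_op_def id by (simp_all add: vec_eq_iff)
    then show ?thesis
      using ph by blast
  next
    assume cnj: "\<kappa> = cnj \<and> CARD('n) = 1"
    then have eq: "i = j" for i j :: 'n
      by (metis card_1_singletonE UNIV_I singletonD)
    \<comment> \<open>With a single index, entrywise conjugation is the adjoint.\<close>
    have "cnj (ip f f' $ i $ j) = ip f' f $ i $ j" for f f' i j
      using ip_commute[of f' f] eq[of i j] by simp
    moreover have "(\<chi> i j. cnj (mat c $ i $ j)) = (mat (cnj c) :: 'n cmat)" for c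
      by (simp add: vec_eq_iff mat_def)
    ultimately have "antiunitary_op act ip U"
      using U cnj unfolding antiunitary_op_def by (simp add: vec_eq_iff)
    then show ?thesis
      using ph cnj by auto
  qed
qed

end
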